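(* For any confusion graph $\Gamma$ and any approximation graph $\Theta$ on the same finite source alphabet $\mathcal{X}$, the approximate-guess maximal leakage rate $\mathcal{L}_\Theta$ and the maximal leakage rate $\mathcal{L}$ satisfy $$\mathcal{L}_\Theta\le\mathcal{L}.$$
   Context: Graphs are finite, simple and undirected. The confusion graph $\Gamma$ and the adversary's approximation graph $\Theta$ both have vertex set $\mathcal{X}$, the finite alphabet of a discrete memoryless stationary source (so $P_{X^t}(x^t)=\prod_jP_X(x_j)$). For a positive integer $t$, $\Gamma_t=\Gamma^{\lor t}$ is the graph on $\mathcal{X}^t$ in which $x^t,v^t$ are adjacent iff $\{x_j,v_j\}$ is an edge of $\Gamma$ for some $j$. $\Theta_t=\Theta^{\boxtimes t}$ is the graph on $\mathcal{X}^t$ in which distinct $x^t,v^t$ are adjacent iff for every $j$, $x_j=v_j$ or $\{x_j,v_j\}$ is an edge of $\Theta$. $N(\Theta_t,x^t)$ is the closed neighborhood of $x^t$ in $\Theta_t$ (including $x^t$). A mapping scheme is a conditional distribution $P_{Y|X^t}$ from $\mathcal{X}^t$ to a finite code alphabet $\mathcal{Y}$ (which may be chosen freely); it is valid if for every $y$ the set $\{x^t: P_{Y|X^t}(y|x^t)>0\}$ is an independent set of $\Gamma_t$. For a valid mapping, $$L^t_\Theta(P_{Y|X^t})=\log\max_{P_X}\frac{\sum_{y\in\mathcal{Y}}\max_{x^t\in\mathcal{X}^t}\sum_{\tilde x^t\in N(\Theta_t,x^t)}P_{X^t}(\tilde x^t)P_{Y|X^t}(y|\tilde x^t)}{\max_{x^t\in\mathcal{X}^t}\sum_{\tilde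 x^t\in N(\Theta_t,x^t)}P_{X^t}(\tilde x^t)},$$ $$L^t(P_{Y|X^t})=\log\max_{P_X}\frac{\sum_{y\in\mathcal{Y}}\max_{x^t\in\mathcal{X}^t}P_{X^t}(x^t)P_{Y|X^t}(y|x^t)}{\max_{x^t\in\mathcal{X}^t}P_{X^t}(x^t)}=\log\sum_{y\in\mathcal{Y}}\max_{x^t\in\mathcal{X}^t}P_{Y|X^t}(y|x^t),$$ the outer maxima being over all probability distributions $P_X$ on $\mathcal{X}$. The rates are $\mathcal{L}_\Theta=\lim_{t\to\infty}\frac1t\inf L^t_\Theta(P_{Y|X^t})$ and $\mathcal{L}=\lim_{t\to\infty}\frac1t\inf L^t(P_{Y|X^t})$, with infima over valid mappings for length $t$; the limits are assumed to exist. The logarithm has a fixed base greater than 1. *)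

theory Defs
  imports "HOL-Probability.Probability" "Graph_Theory.Pair_Digraph"
begin

text \<open>
  A finite simple undirected graph is a \<open>pair_graph\<close>: the edge \<open>{x, v}\<close> is present iff
  both arcs \<open>(x, v)\<close> and \<open>(v, x)\<close> are in \<open>parcs\<close>.  A sequence of length \<open>t\<close> over \<open>X\<close> is an
  element of \<open>{..<t} \<rightarrow>\<^sub>E X\<close>, so positions are numbered from 0.
\<close>

abbreviation seqs :: "nat \<Rightarrow> 'a set \<Rightarrow> (nat \<Rightarrow> 'a) set" where
  "seqs t X \<equiv> {..<t} \<rightarrow>\<^sub>E X"

definition or_power :: "'a pair_pre_digraph \<Rightarrow> nat \<Rightarrow> (nat \<Rightarrow> 'a) pair_pre_digraph" where
  "or_power G t =
     \<lparr> pverts = seqs t (pverts G),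
       parcs = {(x, v). x \<in> seqs t (pverts G) \<and> v \<in> seqs t (pverts G) \<and>
                  (\<exists>j<t. (x j, v j) \<in> parcs G)} \<rparr>"

definition strong_power :: "'a pair_pre_digraph \<Rightarrow> nat \<Rightarrow> (nat \<Rightarrow> 'a) pair_pre_digraph" where
  "strong_power G t =
     \<lparr> pverts = seqs t (pverts G),
       parcs = {(x, v). x \<in> seqs t (pverts G) \<and> v \<in> seqs t (pverts G) \<and> x \<noteq> v \<and>
                  (\<forall>j<t. x j = v j \<or> (x j, v j) \<in> parcs G)} \<rparr>"

definition independent_set :: "'a pair_pre_digraph \<Rightarrow> 'a set \<Rightarrow> bool" where
  "independent_set G S \<longleftrightarrow> S \<subseteq> pverts G \<and> (\<forall>u\<in>S. \<forall>v\<in>S. (u, v) \<notin> parcs G)"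

definition closed_nbhd :: "'a pair_pre_digraph \<Rightarrow> 'a \<Rightarrow> 'a set" where
  "closed_nbhd G u = insert u {v. (u, v) \<in> parcs G}"

definition source_dists :: "'a set \<Rightarrow> 'a pmf set" where
  "source_dists X = {p. set_pmf p \<subseteq> X}"

definition seq_prob :: "nat \<Rightarrow> 'a pmf \<Rightarrow> (nat \<Rightarrow> 'a) \<Rightarrow> real" where
  "seq_prob t p x = (\<Prod>j<t. pmf p (x j))"

text \<open>
  A mapping scheme is a code alphabet \<open>Y\<close> with a kernel \<open>P\<close>, where \<open>pmf (P x) y\<close> is the probability
  of the codeword \<open>y\<close> given \<open>x\<close>.  Only the values of \<open>P\<close> on sequences of length \<open>t\<close> matter.  The freely
  chosen finite alphabet is a finite set of natural numbers; this covers every finite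
  alphabet up to renaming the codewords, which changes neither validity nor leakage.
\<close>

definition mapping_scheme ::
  "'a set \<Rightarrow> nat \<Rightarrow> nat set \<Rightarrow> ((nat \<Rightarrow> 'a) \<Rightarrow> nat pmf) \<Rightarrow> bool" where
  "mapping_scheme X t Y P \<longleftrightarrow> finite Y \<and> (\<forall>x\<in>seqs t X. set_pmf (P x) \<subseteq> Y)"

definition valid_mapping ::
  "'a pair_pre_digraph \<Rightarrow> nat \<Rightarrow> nat set \<Rightarrow> ((nat \<Rightarrow> 'a) \<Rightarrow> nat pmf) \<Rightarrow> bool" where
  "valid_mapping \<Gamma> t Y P \<longleftrightarrow>
     mapping_scheme (pverts \<Gamma>) t Y P \<and>
     (\<forall>y\<in>Y. independent_set (or_power \<Gamma> t) {x \<in> seqs t (pverts \<Gamma>). pmf (P x) y > 0})"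

text \<open>
  The maximum over source distributions is written as a supremum.  It is attained: the ratio is
  continuous on the compact probability simplex, since its denominator is positive there.
\<close>

definition approx_guess_leakage ::
  "real \<Rightarrow> 'a pair_pre_digraph \<Rightarrow> nat \<Rightarrow> nat set \<Rightarrow> ((nat \<Rightarrow> 'a) \<Rightarrow> nat pmf) \<Rightarrow> real" where
  "approx_guess_leakage b \<Theta> t Y P =
     log b (SUP p\<in>source_dists (pverts \<Theta>).
       (\<Sum>y\<in>Y. MAX x\<in>seqs t (pverts \<Theta>).
          \<Sum>x'\<in>closed_nbhd (strong_power \<Theta> t) x. seq_prob t p x' * pmf (P x') y) /
       (MAX x\<in>seqs t (pverts \<Theta>).
          \<Sum>x'\<in>closed_nbhd (strong_power \<Theta> t) x. seq_prob t p x'))"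

definition max_leakage ::
  "real \<Rightarrow> 'a set \<Rightarrow> nat \<Rightarrow> nat set \<Rightarrow> ((nat \<Rightarrow> 'a) \<Rightarrow> nat pmf) \<Rightarrow> real" where
  "max_leakage b X t Y P =
     log b (SUP p\<in>source_dists X.
       (\<Sum>y\<in>Y. MAX x\<in>seqs t X. seq_prob t p x * pmf (P x) y) /
       (MAX x\<in>seqs t X. seq_prob t p x))"

definition opt_approx_guess_leakage ::
  "real \<Rightarrow> 'a pair_pre_digraph \<Rightarrow> 'a pair_pre_digraph \<Rightarrow> nat \<Rightarrow> real" where
  "opt_approx_guess_leakage b \<Gamma> \<Theta> t =
     (INF (Y, P)\<in>{(Y, P). valid_mapping \<Gamma> t Y P}. approx_guess_leakage b \<Theta> t Y P)"

definition opt_max_leakage :: "real \<Rightarrow> 'a pair_pre_digraph \<Rightarrow> nat \<Rightarrow> real" where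
  "opt_max_leakage b \<Gamma> t =
     (INF (Y, P)\<in>{(Y, P). valid_mapping \<Gamma> t Y P}. max_leakage b (pverts \<Gamma>) t Y P)"

text \<open>
  \<open>lim\<close> is unspecified for a divergent sequence, so a statement about the two rates has to assume
  convergence.
\<close>

definition approx_guess_leakage_rate ::
  "real \<Rightarrow> 'a pair_pre_digraph \<Rightarrow> 'a pair_pre_digraph \<Rightarrow> real" where
  "approx_guess_leakage_rate b \<Gamma> \<Theta> = lim (\<lambda>t. (1 / real t) * opt_approx_guess_leakage b \<Gamma> \<Theta> t)"

definition max_leakage_rate :: "real \<Rightarrow> 'a pair_pre_digraph \<Rightarrow> real" where
  "max_leakage_rate b \<Gamma> = lim (\<lambda>t. (1 / real t) * opt_max_leakage b \<Gamma> t)"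

end

theory Submission
  imports Defs
begin

text \<open>
  Bounding \<open>P(y | x')\<close> by \<open>max\<^sub>x P(y | x)\<close> inside the neighbourhood sums gives
  \<open>L\<^sup>t\<^sub>\<Theta>(P) \<le> log (\<Sum>y. max\<^sub>x P(y | x))\<close> for every mapping.  The right-hand side is at most \<open>L\<^sup>t(P)\<close>,
  because the uniform source makes all sequences equally likely.  So the inequality already holds
  for each mapping and each \<open>t\<close>.
\<close>

text \<open>A common form of both leakage ratios: \<open>N\<close> the closed neighbourhood in the
  strong power gives the approximate-guess one, and \<open>N x = {x}\<close> gives the ordinary one.
  Bounds for general \<open>N\<close> then serve both.\<close>

definition guess_ratio ::
  "'s set \<Rightarrow> ('s \<Rightarrow> 's set) \<Rightarrow> ('s \<Rightarrow> real) \<Rightarrow> 'y set \<Rightarrow> ('s \<Rightarrow> 'y pmf) \<Rightarrow> real" where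
  "guess_ratio S N q Y P =
     (\<Sum>y\<in>Y. MAX x\<in>S. \<Sum>x'\<in>N x. q x' * pmf (P x') y) / (MAX x\<in>S. \<Sum>x'\<in>N x. q x')"

context
  fixes S :: "'s set" and N :: "'s \<Rightarrow> 's set" and q :: "'s \<Rightarrow> real"
    and Y :: "'y set" and P :: "'s \<Rightarrow> 'y pmf"
  assumes fin: "finite S" and fin_Y: "finite Y"
    and nbhd: "\<And>x. x \<in> S \<Longrightarrow> x \<in> N x \<and> N x \<subseteq> S"
    and nonneg: "\<And>x. 0 \<le> q x" and pos: "\<exists>x\<in>S. 0 < q x"
begin

lemma Max_nbhd_mass_pos: "0 < (MAX x\<in>S. \<Sum>x'\<in>N x. q x')"
proof -
  obtain x where x: "x \<in> S" "0 < q x" using pos by blast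
  have "finite (N x)" using nbhd[OF x(1)] fin finite_subset by blast
  then have "q x \<le> (\<Sum>x'\<in>N x. q x')"
    using nbhd[OF x(1)] nonneg by (intro member_le_sum) auto
  also have "\<dots> \<le> (MAX x\<in>S. \<Sum>x'\<in>N x. q x')"
    using fin x by (intro Max_ge) auto
  finally show ?thesis using x by linarith
qed

lemma guess_ratio_le: "guess_ratio S N q Y P \<le> (\<Sum>y\<in>Y. MAX x\<in>S. pmf (P x) y)"
proof -
  let ?D = "MAX x\<in>S. \<Sum>x'\<in>N x. q x'"
  have "(MAX x\<in>S. \<Sum>x'\<in>N x. q x' * pmf (P x') y) \<le> (MAX x\<in>S. pmf (P x) y) * ?D" for y
  proof (rule Max.boundedI)
    let ?m = "MAX x\<in>S. pmf (P x) y"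
    fix a assume "a \<in> (\<lambda>x. \<Sum>x'\<in>N x. q x' * pmf (P x') y) ` S"
    then obtain x where x: "x \<in> S" and a: "a = (\<Sum>x'\<in>N x. q x' * pmf (P x') y)" by blast
    have m: "pmf (P z) y \<le> ?m" if "z \<in> S" for z
      using fin that by (intro Max_ge) auto
    have "a \<le> (\<Sum>x'\<in>N x. q x' * ?m)"
      unfolding a using nbhd[OF x] by (intro sum_mono mult_left_mono m nonneg) auto
    also have "\<dots> = (\<Sum>x'\<in>N x. q x') * ?m"
      by (rule sum_distrib_right[symmetric])
    \<comment> \<open>Enlarging the neighbourhood mass to \<open>?D\<close> keeps the inequality
      because \<open>?m\<close> dominates a probability and is therefore nonnegative.\<close>
    also have "\<dots> \<le> ?D * ?m"
      using fin x order_trans[OF pmf_nonneg m[OF x]]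
      by (intro mult_right_mono Max_ge[OF _ imageI]) simp_all
    finally show "a \<le> ?m * ?D" by (simp only: mult.commute)
  qed (use fin pos in auto)
  then have "(\<Sum>y\<in>Y. MAX x\<in>S. \<Sum>x'\<in>N x. q x' * pmf (P x') y)
      \<le> (\<Sum>y\<in>Y. MAX x\<in>S. pmf (P x) y) * ?D"
    unfolding sum_distrib_right by (intro sum_mono)
  then show ?thesis
    unfolding guess_ratio_def using Max_nbhd_mass_pos by (simp add: divide_le_eq)
qed

text \<open>Each \<open>P z\<close> has total mass 1 on \<open>Y\<close>, so the mass of any
  neighbourhood splits over the codewords, and each share is at most the maximum for its codeword.
  This keeps the arguments of the logarithms positive and the leakages nonnegative.\<close>

lemma guess_ratio_ge_1:
  assumes "\<And>x. x \<in> S \<Longrightarrow> set_pmf (P x) \<subseteq> Y"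
  shows "1 \<le> guess_ratio S N q Y P"
proof -
  let ?U = "\<Sum>y\<in>Y. MAX x\<in>S. \<Sum>x'\<in>N x. q x' * pmf (P x') y"
  have "(MAX x\<in>S. \<Sum>x'\<in>N x. q x') \<le> ?U"
  proof (rule Max.boundedI)
    fix a assume "a \<in> (\<lambda>x. \<Sum>x'\<in>N x. q x') ` S"
    then obtain x where x: "x \<in> S" and a: "a = (\<Sum>x'\<in>N x. q x')" by blast
    have "a = (\<Sum>x'\<in>N x. \<Sum>y\<in>Y. q x' * pmf (P x') y)"
      unfolding a
    proof (intro sum.cong refl)
      fix z assume "z \<in> N x"
      then have "(\<Sum>y\<in>Y. pmf (P z) y) = 1"
        using nbhd[OF x] assms fin_Y by (intro sum_pmf_eq_1) auto
      then show "q z = (\<Sum>y\<in>Y. q z * pmf (P z) y)"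
        by (simp flip: sum_distrib_left)
    qed
    also have "\<dots> = (\<Sum>y\<in>Y. \<Sum>x'\<in>N x. q x' * pmf (P x') y)"
      by (rule sum.swap)
    also have "\<dots> \<le> ?U"
      using fin x by (intro sum_mono Max_ge) auto
    finally show "a \<le> ?U" .
  qed (use fin pos in auto)
  then show ?thesis
    unfolding guess_ratio_def using Max_nbhd_mass_pos by (simp add: le_divide_eq)
qed

end

text \<open>A constant weight factors out of every maximum and cancels; this is the equality case of
  \<open>guess_ratio_le\<close> for singleton neighbourhoods.\<close>

lemma guess_ratio_const:
  assumes "finite S" "S \<noteq> {}" "0 < c" "\<And>x. x \<in> S \<Longrightarrow> q x = c"
  shows "guess_ratio S (\<lambda>x. {x}) q Y P = (\<Sum>y\<in>Y. MAX x\<in>S. pmf (P x) y)"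
proof -
  have "(MAX x\<in>S. c * pmf (P x) y) = c * (MAX x\<in>S. pmf (P x) y)" for y
    using mono_Max_commute[of "(*) c" "(\<lambda>x. pmf (P x) y) ` S"] assms
    by (auto simp: mono_def image_image)
  then have "guess_ratio S (\<lambda>x. {x}) q Y P = (\<Sum>y\<in>Y. c * (MAX x\<in>S. pmf (P x) y)) / c"
    unfolding guess_ratio_def using assms by simp
  then show ?thesis using assms by (simp flip: sum_distrib_left)
qed

lemma seq_prob_nonneg: "0 \<le> seq_prob t p x"
  by (simp add: seq_prob_def prod_nonneg)

lemma seq_prob_pos_ex:
  assumes "p \<in> source_dists X"
  shows "\<exists>x\<in>seqs t X. 0 < seq_prob t p x"
proof -
  obtain a where a: "a \<in> set_pmf p" using set_pmf_not_empty[of p] by blast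
  then have "a \<in> X" using assms by (auto simp: source_dists_def)
  \<comment> \<open>The witness repeats one support point of \<open>p\<close>;
    \<open>restrict\<close> makes it extensional, as membership in \<open>seqs\<close>
    demands.\<close>
  then have "restrict (\<lambda>_. a) {..<t} \<in> seqs t X" by auto
  moreover have "0 < seq_prob t p (restrict (\<lambda>_. a) {..<t})"
    using a by (auto simp: seq_prob_def pmf_positive intro!: prod_pos)
  ultimately show ?thesis by blast
qed

lemma closed_nbhd_strong_power:
  assumes "x \<in> seqs t (pverts \<Theta>)"
  shows "x \<in> closed_nbhd (strong_power \<Theta> t) x \<and>
    closed_nbhd (strong_power \<Theta> t) x \<subseteq> seqs t (pverts \<Theta>)"
  using assms by (auto simp: closed_nbhd_def strong_power_def)

lemma approx_guess_leakage_eq: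
  "approx_guess_leakage b \<Theta> t Y P = log b (SUP p\<in>source_dists (pverts \<Theta>).
     guess_ratio (seqs t (pverts \<Theta>)) (closed_nbhd (strong_power \<Theta> t)) (seq_prob t p) Y P)"
  by (simp add: approx_guess_leakage_def guess_ratio_def)

lemma max_leakage_eq:
  "max_leakage b X t Y P = log b (SUP p\<in>source_dists X.
     guess_ratio (seqs t X) (\<lambda>x. {x}) (seq_prob t p) Y P)"
  by (simp add: max_leakage_def guess_ratio_def)

context
  fixes X :: "'a set" and t :: nat and Y :: "nat set" and P :: "(nat \<Rightarrow> 'a) \<Rightarrow> nat pmf"
  assumes fin_X: "finite X" and ne_X: "X \<noteq> {}" and scheme: "mapping_scheme X t Y P"
begin

text \<open>The bound \<open>M\<close> depends neither on the source nor on \<open>N\<close>, so it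
  survives the supremum. Boundedness is recorded separately because a supremum of reals is only
  meaningful with it.\<close>

lemma SUP_guess_ratio_bounds:
  assumes "\<And>x. x \<in> seqs t X \<Longrightarrow> x \<in> N x \<and> N x \<subseteq> seqs t X"
  defines "M \<equiv> \<Sum>y\<in>Y. MAX x\<in>seqs t X. pmf (P x) y"
  shows "bdd_above ((\<lambda>p. guess_ratio (seqs t X) N (seq_prob t p) Y P) ` source_dists X)"
    and "1 \<le> (SUP p\<in>source_dists X. guess_ratio (seqs t X) N (seq_prob t p) Y P)"
    and "(SUP p\<in>source_dists X. guess_ratio (seqs t X) N (seq_prob t p) Y P) \<le> M"
proof -
  let ?r = "\<lambda>p. guess_ratio (seqs t X) N (seq_prob t p) Y P"
  have fin: "finite (seqs t X)" "finite Y"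
    using fin_X scheme by (auto simp: mapping_scheme_def intro: finite_PiE)
  obtain a where "a \<in> X" using ne_X by blast
  then have ret: "return_pmf a \<in> source_dists X" by (simp add: source_dists_def)
  have le: "?r p \<le> M" if "p \<in> source_dists X" for p
    unfolding M_def using fin assms(1) seq_prob_nonneg seq_prob_pos_ex[OF that]
    by (intro guess_ratio_le) auto
  have ge: "1 \<le> ?r p" if "p \<in> source_dists X" for p
    using fin assms(1) seq_prob_nonneg seq_prob_pos_ex[OF that] scheme
    by (intro guess_ratio_ge_1) (auto simp: mapping_scheme_def)
  show bdd: "bdd_above (?r ` source_dists X)" using le by (rule bdd_aboveI2)
  show "1 \<le> (SUP p\<in>source_dists X. ?r p)" using cSUP_upper2[OF bdd ret ge[OF ret]] .
  show "(SUP p\<in>source_dists X. ?r p) \<le> M" using ret le by (intro cSUP_least) auto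
qed

lemma SUP_guess_ratio_singleton:
  "(SUP p\<in>source_dists X. guess_ratio (seqs t X) (\<lambda>x. {x}) (seq_prob t p) Y P)
     = (\<Sum>y\<in>Y. MAX x\<in>seqs t X. pmf (P x) y)"
proof (rule antisym)
  note bounds = SUP_guess_ratio_bounds[of "\<lambda>x. {x}"]
  show "(SUP p\<in>source_dists X. guess_ratio (seqs t X) (\<lambda>x. {x}) (seq_prob t p) Y P)
      \<le> (\<Sum>y\<in>Y. MAX x\<in>seqs t X. pmf (P x) y)"
    by (rule bounds) auto
  \<comment> \<open>The uniform source attains the upper bound, since it gives every sequence the
    probability \<open>(1 / card X) ^ t\<close>.\<close>
  let ?u = "pmf_of_set X"
  have u: "?u \<in> source_dists X" using fin_X ne_X by (simp add: source_dists_def)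
  have "guess_ratio (seqs t X) (\<lambda>x. {x}) (seq_prob t ?u) Y P
      = (\<Sum>y\<in>Y. MAX x\<in>seqs t X. pmf (P x) y)"
  proof (rule guess_ratio_const[where c = "(1 / card X) ^ t"])
    show "seq_prob t ?u x = (1 / card X) ^ t" if "x \<in> seqs t X" for x
    proof -
      have "pmf ?u (x j) = 1 / card X" if "j < t" for j
        using \<open>x \<in> seqs t X\<close> that fin_X ne_X by (auto simp: PiE_iff indicator_def)
      then show ?thesis by (simp add: seq_prob_def)
    qed
  qed (use fin_X ne_X in \<open>auto simp: card_gt_0_iff PiE_eq_empty_iff intro: finite_PiE\<close>)
  then show "(\<Sum>y\<in>Y. MAX x\<in>seqs t X. pmf (P x) y)
      \<le> (SUP p\<in>source_dists X. guess_ratio (seqs t X) (\<lambda>x. {x}) (seq_prob t p) Y P)"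
    using cSUP_upper[OF u bounds(1)] by auto
qed

lemma
  assumes b: "b > 1" and \<Theta>: "pverts \<Theta> = X"
  shows approx_guess_leakage_nonneg: "0 \<le> approx_guess_leakage b \<Theta> t Y P"
    and approx_guess_leakage_le_max_leakage:
      "approx_guess_leakage b \<Theta> t Y P \<le> max_leakage b X t Y P"
proof -
  let ?s = "SUP p\<in>source_dists X.
    guess_ratio (seqs t X) (closed_nbhd (strong_power \<Theta> t)) (seq_prob t p) Y P"
  note bounds = SUP_guess_ratio_bounds[OF closed_nbhd_strong_power[of _ t \<Theta>, unfolded \<Theta>]]
  have ge: "1 \<le> ?s" by (rule bounds(2))
  have le: "?s \<le> (\<Sum>y\<in>Y. MAX x\<in>seqs t X. pmf (P x) y)" by (rule bounds(3))
  show "0 \<le> approx_guess_leakage b \<Theta> t Y P"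
    unfolding approx_guess_leakage_eq \<Theta>
    by (rule zero_le_log_cancel_iff[THEN iffD2, OF b _ ge]) (use ge in linarith)
  show "approx_guess_leakage b \<Theta> t Y P \<le> max_leakage b X t Y P"
    unfolding approx_guess_leakage_eq max_leakage_eq SUP_guess_ratio_singleton \<Theta>
    by (rule log_mono[OF b _ le]) (use ge in linarith)
qed

end

text \<open>Encoding the sequences injectively and deterministically leaves at most one sequence per
  codeword, and a loopless graph has no arc inside such a set. This makes the infima range over a
  nonempty set.\<close>

lemma valid_mapping_ex:
  assumes "pair_graph \<Gamma>"
  shows "\<exists>Y P. valid_mapping \<Gamma> t Y P"
proof -
  interpret pair_graph \<Gamma> by fact
  let ?S = "seqs t (pverts \<Gamma>)"
  have "finite ?S" by (auto intro: finite_PiE)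
  then obtain f :: "(nat \<Rightarrow> 'a) \<Rightarrow> nat" where f: "inj_on f ?S"
    using finite_imp_inj_to_nat_seg by blast
  have "independent_set (or_power \<Gamma> t) {x \<in> ?S. pmf (return_pmf (f x)) y > 0}" for y
    unfolding independent_set_def
  proof (intro conjI ballI)
    fix u v
    assume u: "u \<in> {x \<in> ?S. pmf (return_pmf (f x)) y > 0}"
      and v: "v \<in> {x \<in> ?S. pmf (return_pmf (f x)) y > 0}"
    then have "f u = f v" by (auto simp: indicator_def split: if_splits)
    then have "u = v" using f u v by (auto dest: inj_onD)
    moreover have "(a, a) \<notin> parcs \<Gamma>" for a using pair_no_loops[of "(a, a)"] by auto
    ultimately show "(u, v) \<notin> parcs (or_power \<Gamma> t)" by (simp add: or_power_def)
  qed (auto simp: or_power_def)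
  then have "valid_mapping \<Gamma> t (f ` ?S) (\<lambda>x. return_pmf (f x))"
    using \<open>finite ?S\<close> by (auto simp: valid_mapping_def mapping_scheme_def)
  then show ?thesis by blast
qed

lemma opt_approx_guess_leakage_le:
  assumes "b > 1" "pverts \<Gamma> \<noteq> {}" "pair_graph \<Gamma>" "pverts \<Theta> = pverts \<Gamma>"
  shows "opt_approx_guess_leakage b \<Gamma> \<Theta> t \<le> opt_max_leakage b \<Gamma> t"
proof -
  interpret pair_graph \<Gamma> by fact
  let ?V = "{(Y, P). valid_mapping \<Gamma> t Y P}"
  have scheme: "mapping_scheme (pverts \<Gamma>) t Y P" if "(Y, P) \<in> ?V" for Y P
    using that by (simp add: valid_mapping_def)
  show ?thesis
    unfolding opt_approx_guess_leakage_def opt_max_leakage_def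
  \<comment> \<open>The infima are compared mapping by mapping, with the same \<open>(Y, P)\<close>
    on both sides; nonnegativity of the approximate-guess leakage supplies the lower bound that the
    left infimum requires.\<close>
  proof (rule cINF_mono)
    show "?V \<noteq> {}" using valid_mapping_ex[OF assms(3)] by auto
    show "bdd_below ((\<lambda>(Y, P). approx_guess_leakage b \<Theta> t Y P) ` ?V)"
      using approx_guess_leakage_nonneg[OF _ assms(2) scheme assms(1,4)]
      by (intro bdd_belowI2[of _ 0]) auto
    show "\<exists>n\<in>?V. (case n of (Y, P) \<Rightarrow> approx_guess_leakage b \<Theta> t Y P)
        \<le> (case m of (Y, P) \<Rightarrow> max_leakage b (pverts \<Gamma>) t Y P)" if "m \<in> ?V" for m
      using approx_guess_leakage_le_max_leakage[OF _ assms(2) scheme assms(1,4)] that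
      by (intro bexI[of _ m]) auto
  qed
qed

theorem lemma5:
  fixes \<Gamma> \<Theta> :: "'a pair_pre_digraph" and X :: "'a set" and b :: real
  assumes "b > 1"
    and "X \<noteq> {}"
    and "pair_graph \<Gamma>" and "pverts \<Gamma> = X"
    and "pair_graph \<Theta>" and "pverts \<Theta> = X"
    and "convergent (\<lambda>t. (1 / real t) * opt_approx_guess_leakage b \<Gamma> \<Theta> t)"
    and "convergent (\<lambda>t. (1 / real t) * opt_max_leakage b \<Gamma> t)"
  shows "approx_guess_leakage_rate b \<Gamma> \<Theta> \<le> max_leakage_rate b \<Gamma>"
proof -
  let ?L\<Theta> = "\<lambda>t. (1 / real t) * opt_approx_guess_leakage b \<Gamma> \<Theta> t"
  let ?L = "\<lambda>t. (1 / real t) * opt_max_leakage b \<Gamma> t"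
  have opt: "opt_approx_guess_leakage b \<Gamma> \<Theta> t \<le> opt_max_leakage b \<Gamma> t" for t
    by (rule opt_approx_guess_leakage_le) (simp_all only: assms not_False_eq_True)
  \<comment> \<open>At \<open>t = 0\<close> the factor \<open>1 / real t\<close> is 0 by the
    convention for division, so the inequality holds there too.\<close>
  have "?L\<Theta> t \<le> ?L t" for t
    by (rule mult_left_mono[OF opt]) simp
  \<comment> \<open>The convergence hypotheses turn each \<open>lim\<close> into an actual limit,
    and limits preserve the termwise inequality.\<close>
  then have "lim ?L\<Theta> \<le> lim ?L"
    using assms(7,8)[unfolded convergent_LIMSEQ_iff] by (intro LIMSEQ_le[of ?L\<Theta> _ ?L]) simp_all
  then show ?thesis
    unfolding approx_guess_leakage_rate_def max_leakage_rate_def .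
qed

end
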